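(* Let $X$ be a $\odot$-consonant topological space (for example, a continuous Yoneda-complete quasi-metric space with its $d$-Scott topology). Then the compact-open topology on $\mathcal{L} X$ is equal to the Scott topology on $\mathcal{L} X$.
   Context: Compact does not include any separation axiom; saturated means being an intersection of open sets. A topological space is consonant iff, for every Scott-open family $\mathcal{U}$ of open sets (Scott-open in the lattice of open subsets ordered by inclusion) and every $U \in \mathcal{U}$, there is a compact saturated set $Q \subseteq U$ such that every open neighborhood of $Q$ belongs to $\mathcal{U}$. A space $X$ is $\odot$-consonant iff for every $n \in \mathbb{N}$ the topological coproduct of $n$ copies of $X$ is consonant. $\mathcal{L} X$ is the set of lower semicontinuous maps from $X$ to $[0,+\infty]$ (i.e. continuous maps when $[0,+\infty]$ has its Scott topology, whose proper non-empty open sets are the intervals $]t,+\infty]$), ordered pointwise. The Scott topology on a poset has as open sets the upwards-closed sets $U$ such that every directed family having a supremum in $U$ intersects $U$. The compact-open topology on $\mathcal{L} X$ is generated by the subbasic open sets $\{f \in \mathcal{L} X \mid \forall x \in Q,\ f(x) > a\}$, with $Q$ compact saturated in $X$ and $a \in \mathbb{R}$. For the example: a quasi-metric on $X$ is a map $d \colon X \times X \to [0,+\infty]$ with $d(x,x)=0$, the triangle inequality, and $d(x,y)=d(y,x)=0 \Rightarrow x=y$. Formal balls are pairs $(x,r)$, $x\in X$, $r\in [0,+\infty)$, ordered by $(x,r) \leq^{d^+} (y,s)$ iff $d(x,y) \leq r-s$; they form the poset $\mathbf{B}(X,d)$, with its Scott topology. The $d$-Scott topology on $X$ is the coarsest one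 making $x \mapsto (x,0) \in \mathbf{B}(X,d)$ continuous. $X,d$ is continuous Yoneda-complete iff $\mathbf{B}(X,d)$ is a continuous dcpo. *)

theory Defs
  imports "HOL-Analysis.Analysis"
begin

section \<open>Posets given by a carrier and an order relation\<close>

definition directed_in :: "'a set \<Rightarrow> ('a \<Rightarrow> 'a \<Rightarrow> bool) \<Rightarrow> 'a set \<Rightarrow> bool" where
  "directed_in P le D \<longleftrightarrow>
     D \<subseteq> P \<and> D \<noteq> {} \<and> (\<forall>x\<in>D. \<forall>y\<in>D. \<exists>z\<in>D. le x z \<and> le y z)"

definition supremum_in :: "'a set \<Rightarrow> ('a \<Rightarrow> 'a \<Rightarrow> bool) \<Rightarrow> 'a set \<Rightarrow> 'a \<Rightarrow> bool" where
  "supremum_in P le D s \<longleftrightarrow>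
     s \<in> P \<and> (\<forall>x\<in>D. le x s) \<and> (\<forall>u\<in>P. (\<forall>x\<in>D. le x u) \<longrightarrow> le s u)"

definition scott_open :: "'a set \<Rightarrow> ('a \<Rightarrow> 'a \<Rightarrow> bool) \<Rightarrow> 'a set \<Rightarrow> bool" where
  "scott_open P le U \<longleftrightarrow>
     U \<subseteq> P \<and>
     (\<forall>x\<in>U. \<forall>y\<in>P. le x y \<longrightarrow> y \<in> U) \<and>
     (\<forall>D s. directed_in P le D \<and> supremum_in P le D s \<and> s \<in> U \<longrightarrow> D \<inter> U \<noteq> {})"

definition scott_topology :: "'a set \<Rightarrow> ('a \<Rightarrow> 'a \<Rightarrow> bool) \<Rightarrow> 'a topology" where
  "scott_topology P le = topology (scott_open P le)"

lemma istopology_scott_open: "istopology (scott_open P le)"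
  unfolding istopology_def
proof (intro conjI allI impI)
  fix U V assume U: "scott_open P le U" and V: "scott_open P le V"
  show "scott_open P le (U \<inter> V)"
    unfolding scott_open_def
  proof (intro conjI allI impI)
    show "U \<inter> V \<subseteq> P" "\<forall>x\<in>U \<inter> V. \<forall>y\<in>P. le x y \<longrightarrow> y \<in> U \<inter> V"
      using U V unfolding scott_open_def by blast+
    fix D s assume D: "directed_in P le D \<and> supremum_in P le D s \<and> s \<in> U \<inter> V"
    then obtain x y where "x \<in> D" "x \<in> U" "y \<in> D" "y \<in> V"
      using U V unfolding scott_open_def by blast
    moreover then obtain z where "z \<in> D" "z \<in> P" "le x z" "le y z"
      using D unfolding directed_in_def by blast
    ultimately show "D \<inter> (U \<inter> V) \<noteq> {}"
      using U V unfolding scott_open_def by blast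
  qed
next
  fix K assume K: "\<forall>U\<in>K. scott_open P le U"
  show "scott_open P le (\<Union>K)"
    unfolding scott_open_def
  proof (intro conjI allI impI)
    show "\<Union>K \<subseteq> P" "\<forall>x\<in>\<Union>K. \<forall>y\<in>P. le x y \<longrightarrow> y \<in> \<Union>K"
      using K unfolding scott_open_def by blast+
    fix D s assume D: "directed_in P le D \<and> supremum_in P le D s \<and> s \<in> \<Union>K"
    then obtain U where "U \<in> K" "s \<in> U" by blast
    with D K have "D \<inter> U \<noteq> {}" unfolding scott_open_def by blast
    with \<open>U \<in> K\<close> show "D \<inter> \<Union>K \<noteq> {}" by blast
  qed
qed

lemma openin_scott_topology [simp]:
  "openin (scott_topology P le) U \<longleftrightarrow> scott_open P le U"
  by (simp add: scott_topology_def istopology_scott_open)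

lemma topspace_scott_topology [simp]: "topspace (scott_topology P le) = P"
proof -
  have "scott_open P le P"
    by (auto simp: scott_open_def directed_in_def)
  moreover have "U \<subseteq> P" if "scott_open P le U" for U
    using that by (simp add: scott_open_def)
  ultimately show ?thesis
    unfolding topspace_def by (auto, blast)
qed

definition dcpo_on :: "'a set \<Rightarrow> ('a \<Rightarrow> 'a \<Rightarrow> bool) \<Rightarrow> bool" where
  "dcpo_on P le \<longleftrightarrow> (\<forall>D. directed_in P le D \<longrightarrow> (\<exists>s. supremum_in P le D s))"

definition way_below :: "'a set \<Rightarrow> ('a \<Rightarrow> 'a \<Rightarrow> bool) \<Rightarrow> 'a \<Rightarrow> 'a \<Rightarrow> bool" where
  "way_below P le x y \<longleftrightarrow>
     (\<forall>D s. directed_in P le D \<and> supremum_in P le D s \<and> le y s \<longrightarrow> (\<exists>z\<in>D. le x z))"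

definition continuous_dcpo_on :: "'a set \<Rightarrow> ('a \<Rightarrow> 'a \<Rightarrow> bool) \<Rightarrow> bool" where
  "continuous_dcpo_on P le \<longleftrightarrow>
     dcpo_on P le \<and>
     (\<forall>y\<in>P. directed_in P le {x\<in>P. way_below P le x y} \<and>
             supremum_in P le {x\<in>P. way_below P le x y} y)"


section \<open>Consonance\<close>

text \<open>The intersection with the carrier makes the empty intersection the whole space.\<close>

definition saturated_in :: "'a topology \<Rightarrow> 'a set \<Rightarrow> bool" where
  "saturated_in X Q \<longleftrightarrow>
     (\<exists>\<V>. (\<forall>V\<in>\<V>. openin X V) \<and> Q = topspace X \<inter> \<Inter>\<V>)"

definition consonant :: "'a topology \<Rightarrow> bool" where
  "consonant X \<longleftrightarrow>
     (\<forall>\<U> U. scott_open {V. openin X V} (\<subseteq>) \<U> \<and> U \<in> \<U> \<longrightarrow>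
        (\<exists>Q. compactin X Q \<and> saturated_in X Q \<and> Q \<subseteq> U \<and>
             (\<forall>V. openin X V \<and> Q \<subseteq> V \<longrightarrow> V \<in> \<U>)))"

definition odot_consonant :: "'a topology \<Rightarrow> bool" where
  "odot_consonant X \<longleftrightarrow> (\<forall>n::nat. consonant (sum_topology (\<lambda>_. X) {..<n}))"


section \<open>Lower semicontinuous maps and the topologies on them\<close>

text \<open>Maps out of the carrier of \<open>X\<close> are represented as functions that are
  \<^const>\<open>undefined\<close> outside it, so that they are determined by their values on the carrier.\<close>

definition lsc_maps :: "'a topology \<Rightarrow> ('a \<Rightarrow> ennreal) set" where
  "lsc_maps X = {f \<in> extensional (topspace X).
     continuous_map X (scott_topology (UNIV :: ennreal set) (\<le>)) f}"

definition pointwise_le :: "'a topology \<Rightarrow> ('a \<Rightarrow> ennreal) \<Rightarrow> ('a \<Rightarrow> ennreal) \<Rightarrow> bool" where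
  "pointwise_le X f g \<longleftrightarrow> (\<forall>x\<in>topspace X. f x \<le> g x)"

definition lsc_scott_topology :: "'a topology \<Rightarrow> ('a \<Rightarrow> ennreal) topology" where
  "lsc_scott_topology X = scott_topology (lsc_maps X) (pointwise_le X)"

text \<open>The threshold \<open>a\<close> ranges over all reals, negative ones included, hence the comparison
  in \<^typ>\<open>ereal\<close>; a negative \<open>a\<close> gives the whole of \<^term>\<open>lsc_maps X\<close>.\<close>

definition compact_open_topology :: "'a topology \<Rightarrow> ('a \<Rightarrow> ennreal) topology" where
  "compact_open_topology X = topology_generated_by
     {{f \<in> lsc_maps X. \<forall>x\<in>Q. ereal a < enn2ereal (f x)} | Q (a::real).
        compactin X Q \<and> saturated_in X Q}"

lemma topspace_compact_open_topology: "topspace (compact_open_topology X) = lsc_maps X"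
proof -
  have "{f \<in> lsc_maps X. \<forall>x\<in>{}. ereal 0 < enn2ereal (f x)} = lsc_maps X"
    by simp
  moreover have "compactin X {}" "saturated_in X {}"
    unfolding saturated_in_def by (auto intro: exI [of _ "{{}}"])
  ultimately have "lsc_maps X \<in> {{f \<in> lsc_maps X. \<forall>x\<in>Q. ereal a < enn2ereal (f x)} | Q a.
        compactin X Q \<and> saturated_in X Q}"
    by blast
  then show ?thesis
    unfolding compact_open_topology_def topology_generated_by_topspace by blast
qed


section \<open>Quasi-metric spaces\<close>

definition quasi_metric_on :: "'a set \<Rightarrow> ('a \<Rightarrow> 'a \<Rightarrow> ennreal) \<Rightarrow> bool" where
  "quasi_metric_on M d \<longleftrightarrow>
     (\<forall>x\<in>M. d x x = 0) \<and>
     (\<forall>x\<in>M. \<forall>y\<in>M. \<forall>z\<in>M. d x z \<le> d x y + d y z) \<and>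
     (\<forall>x\<in>M. \<forall>y\<in>M. d x y = 0 \<and> d y x = 0 \<longrightarrow> x = y)"

definition formal_balls :: "'a set \<Rightarrow> ('a \<times> real) set" where
  "formal_balls M = M \<times> {0..}"

text \<open>The difference of the radii may be negative (and then the balls are not related), so
  the comparison takes place in \<^typ>\<open>ereal\<close>, not in \<^typ>\<open>ennreal\<close>, where it would be
  truncated.\<close>

definition formal_ball_le ::
  "('a \<Rightarrow> 'a \<Rightarrow> ennreal) \<Rightarrow> 'a \<times> real \<Rightarrow> 'a \<times> real \<Rightarrow> bool" where
  "formal_ball_le d = (\<lambda>(x, r) (y, s). enn2ereal (d x y) \<le> ereal (r - s))"

definition d_scott_topology :: "'a set \<Rightarrow> ('a \<Rightarrow> 'a \<Rightarrow> ennreal) \<Rightarrow> 'a topology" where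
  "d_scott_topology M d =
     pullback_topology M (\<lambda>x. (x, 0)) (scott_topology (formal_balls M) (formal_ball_le d))"

definition continuous_Yoneda_complete :: "'a set \<Rightarrow> ('a \<Rightarrow> 'a \<Rightarrow> ennreal) \<Rightarrow> bool" where
  "continuous_Yoneda_complete M d \<longleftrightarrow>
     continuous_dcpo_on (formal_balls M) (formal_ball_le d)"

end

theory Submission
  imports Defs
begin

text \<open>
  A map \<open>f\<close> in a Scott-open set \<open>\<W>\<close> is a directed supremum of finite step maps, each taking the
  value \<open>r\<close> at least on the open set \<open>{f > r}\<close> for the thresholds \<open>r\<close> of a finite set \<open>F\<close>; so one of
  them is in \<open>\<W>\<close>. The families of open sets indexed by \<open>F\<close> whose step map is in \<open>\<W>\<close> form a
  Scott-open family on the coproduct of \<open>card F\<close> copies of \<open>X\<close>. Consonance of that coproduct gives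
  one compact saturated set per threshold, and these determine a neighbourhood of \<open>f\<close> in the
  compact-open topology that is included in \<open>\<W>\<close>.

  A continuous Yoneda-complete space is the set of formal balls of radius 0, hence a G-delta subset
  of a continuous dcpo, because the radius is Scott-continuous. A G-delta subset \<open>\<Inter>n. V n\<close> of a
  continuous dcpo is consonant: one chooses finite sets \<open>E n \<subseteq> V n\<close>, each way above the previous one,
  whose upper sets remain in the given Scott-open family, and intersects these upper sets; Koenig's
  lemma shows that every open neighbourhood of the intersection contains some \<open>E n\<close>. The coproduct
  of copies of a continuous dcpo is again one, which takes care of the coproducts of the space.
\<close>

section \<open>Scott-open sets of lower semicontinuous maps\<close>

lemma scott_open_ennreal_greaterThan: "scott_open (UNIV :: ennreal set) (\<le>) {t<..}"
  unfolding scott_open_def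
proof (intro conjI allI impI)
  fix D :: "ennreal set" and s
  assume D: "directed_in UNIV (\<le>) D \<and> supremum_in UNIV (\<le>) D s \<and> s \<in> {t<..}"
  then have "\<not> (\<forall>x\<in>D. x \<le> t)"
    unfolding supremum_in_def using leD by auto
  then show "D \<inter> {t<..} \<noteq> {}"
    by (auto simp: not_le)
qed auto

text \<open>By density, a non-zero \<open>w\<close> is the supremum of the directed set of values
  strictly below it; \<open>w \<noteq> 0\<close> keeps that set non-empty.\<close>

lemma scott_open_ennreal_below:
  fixes W :: "ennreal set"
  assumes W: "scott_open UNIV (\<le>) W" and "w \<in> W" "w \<noteq> 0"
  shows "\<exists>t\<in>W. t < w"
proof -
  have "directed_in UNIV (\<le>) {..<w}"
    unfolding directed_in_def
  proof (intro conjI ballI)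
    show "{..<w} \<noteq> {}"
      using \<open>w \<noteq> 0\<close> lessThan_iff[of 0 w] by (metis emptyE not_gr_zero)
    show "\<exists>z\<in>{..<w}. x \<le> z \<and> y \<le> z" if "x \<in> {..<w}" "y \<in> {..<w}" for x y
      using that by (intro bexI[of _ "max x y"]) auto
  qed auto
  moreover have "supremum_in UNIV (\<le>) {..<w} w"
    unfolding supremum_in_def by (auto intro: dense_le)
  ultimately have "{..<w} \<inter> W \<noteq> {}"
    using W \<open>w \<in> W\<close> unfolding scott_open_def by blast
  then show ?thesis by auto
qed

text \<open>A Scott-open set that misses 0 is the union of the open rays above its own members, so
  it suffices to test preimages of rays.\<close>

lemma lsc_maps_iff:
  "f \<in> lsc_maps X \<longleftrightarrow>
     f \<in> extensional (topspace X) \<and> (\<forall>t. openin X {x \<in> topspace X. t < f x})"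
proof (intro iffI conjI allI)
  assume f: "f \<in> lsc_maps X"
  then show "f \<in> extensional (topspace X)" by (simp add: lsc_maps_def)
  fix t
  have "openin X {x \<in> topspace X. f x \<in> {t<..}}"
    using f unfolding lsc_maps_def continuous_map_def
    using scott_open_ennreal_greaterThan by fastforce
  then show "openin X {x \<in> topspace X. t < f x}" by simp
next
  assume f: "f \<in> extensional (topspace X) \<and> (\<forall>t. openin X {x \<in> topspace X. t < f x})"
  have "openin X {x \<in> topspace X. f x \<in> W}" if W: "scott_open UNIV (\<le>) W" for W
  proof (cases "0 \<in> W")
    case True
    then have "W = UNIV" using W unfolding scott_open_def by fastforce
    then show ?thesis by simp
  next
    case False
    have up: "y \<in> W" if "x \<in> W" "x \<le> y" for x y
      using W that unfolding scott_open_def by blast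
    have "{x \<in> topspace X. f x \<in> W} = (\<Union>t\<in>W. {x \<in> topspace X. t < f x})"
    proof (intro equalityI subsetI)
      fix x assume x: "x \<in> {x \<in> topspace X. f x \<in> W}"
      then have "f x \<noteq> 0" using False by auto
      then show "x \<in> (\<Union>t\<in>W. {x \<in> topspace X. t < f x})"
        using scott_open_ennreal_below[OF W, of "f x"] x by blast
    qed (use up less_imp_le in blast)
    then show ?thesis using f by auto
  qed
  then show "f \<in> lsc_maps X"
    using f by (simp add: lsc_maps_def continuous_map_def)
qed

section \<open>Approximation by finite step maps\<close>

definition level :: "'a topology \<Rightarrow> ('a \<Rightarrow> ennreal) \<Rightarrow> real \<Rightarrow> 'a set" where
  "level X f r = {x \<in> topspace X. ennreal r < f x}"

lemma openin_level: "f \<in> lsc_maps X \<Longrightarrow> openin X (level X f r)"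
  by (simp add: level_def lsc_maps_iff)

text \<open>The sets \<open>V r\<close> need not be nested, so that every open set of a coproduct of
  copies of \<open>X\<close> encodes such a map. An empty \<open>F\<close> gives the zero
  map.\<close>

definition step_map :: "'a topology \<Rightarrow> real set \<Rightarrow> (real \<Rightarrow> 'a set) \<Rightarrow> 'a \<Rightarrow> ennreal" where
  "step_map X F V = (\<lambda>x\<in>topspace X. SUP r\<in>F. if x \<in> V r then ennreal r else 0)"

lemma step_map_le_iff:
  assumes "x \<in> topspace X"
  shows "step_map X F V x \<le> c \<longleftrightarrow> (\<forall>r\<in>F. x \<in> V r \<longrightarrow> ennreal r \<le> c)"
  unfolding step_map_def restrict_apply'[OF assms] SUP_le_iff by auto

lemma le_step_map:
  "\<lbrakk>x \<in> topspace X; r \<in> F; x \<in> V r\<rbrakk> \<Longrightarrow> ennreal r \<le> step_map X F V x"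
  using step_map_le_iff[of x X F V "step_map X F V x"] by simp

lemma step_map_mono:
  assumes "F \<subseteq> G" "\<And>r. r \<in> F \<Longrightarrow> V r \<subseteq> W r"
  shows "pointwise_le X (step_map X F V) (step_map X G W)"
  unfolding pointwise_le_def
proof
  fix x assume x: "x \<in> topspace X"
  have "ennreal r \<le> step_map X G W x" if "r \<in> F" "x \<in> V r" for r
    using le_step_map[OF x, of r G W] assms that by blast
  then show "step_map X F V x \<le> step_map X G W x"
    unfolding step_map_le_iff[OF x] by blast
qed

lemma step_map_level_le: "pointwise_le X (step_map X F (level X f)) f"
  unfolding pointwise_le_def by (auto simp: step_map_le_iff level_def)

lemma step_map_lsc:
  assumes "\<And>r. r \<in> F \<Longrightarrow> openin X (V r)"
  shows "step_map X F V \<in> lsc_maps X"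
  unfolding lsc_maps_iff
proof (intro conjI allI)
  show "step_map X F V \<in> extensional (topspace X)"
    by (simp add: step_map_def)
  fix t
  have "{x \<in> topspace X. t < step_map X F V x} = (\<Union>r\<in>{r \<in> F. t < ennreal r}. V r)"
  proof (intro equalityI subsetI)
    fix x assume "x \<in> (\<Union>r\<in>{r \<in> F. t < ennreal r}. V r)"
    then obtain r where r: "r \<in> F" "t < ennreal r" "x \<in> V r" by blast
    then have "x \<in> topspace X" using openin_subset[OF assms] by blast
    with r show "x \<in> {x \<in> topspace X. t < step_map X F V x}"
      using le_step_map[of x X r F V] by (simp add: less_le_trans)
  qed (auto simp: step_map_le_iff simp flip: not_le)
  then show "openin X {x \<in> topspace X. t < step_map X F V x}"
    using assms by auto
qed

text \<open>If an upper bound \<open>u\<close> were below \<open>f\<close> at some point, a value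
  strictly between the two would be finite, hence a threshold \<open>r\<close>, and the step map for
  \<open>{r}\<close> alone would already exceed \<open>u\<close> there.\<close>

lemma supremum_step_maps:
  assumes f: "f \<in> lsc_maps X"
  shows "supremum_in (lsc_maps X) (pointwise_le X)
    ((\<lambda>F. step_map X F (level X f)) ` {F. finite F \<and> F \<subseteq> {0..}}) f"
  unfolding supremum_in_def
proof (intro conjI ballI impI)
  fix u assume "\<forall>g\<in>(\<lambda>F. step_map X F (level X f)) ` {F. finite F \<and> F \<subseteq> {0..}}. pointwise_le X g u"
  then have u: "pointwise_le X (step_map X F (level X f)) u" if "finite F" "F \<subseteq> {0..}" for F
    using that by blast
  show "pointwise_le X f u"
    unfolding pointwise_le_def
  proof (intro ballI leI notI)
    fix x assume x: "x \<in> topspace X" and "u x < f x"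
    then obtain y where y: "u x < y" "y < f x" using dense by blast
    then have "y < top" by (meson less_le_trans top_greatest)
    then obtain r where r: "y = ennreal r" "0 \<le> r"
      by (cases y) auto
    then have "ennreal r \<le> u x"
      using u[of "{r}"] x y by (simp add: pointwise_le_def step_map_le_iff level_def)
    with y r show False by simp
  qed
qed (use f step_map_level_le in auto)

lemma directed_step_maps:
  assumes f: "f \<in> lsc_maps X"
  shows "directed_in (lsc_maps X) (pointwise_le X)
    ((\<lambda>F. step_map X F (level X f)) ` {F. finite F \<and> F \<subseteq> {0..}})"
  unfolding directed_in_def
proof (intro conjI ballI)
  show "(\<lambda>F. step_map X F (level X f)) ` {F. finite F \<and> F \<subseteq> {0..}} \<subseteq> lsc_maps X"
    using f by (auto intro: step_map_lsc openin_level)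
  fix g h
  assume "g \<in> (\<lambda>F. step_map X F (level X f)) ` {F. finite F \<and> F \<subseteq> {0..}}"
    "h \<in> (\<lambda>F. step_map X F (level X f)) ` {F. finite F \<and> F \<subseteq> {0..}}"
  then obtain F G where "finite F" "finite G" "F \<subseteq> {0..}" "G \<subseteq> {0..}"
    "g = step_map X F (level X f)" "h = step_map X G (level X f)"
    by auto
  then show "\<exists>k\<in>(\<lambda>F. step_map X F (level X f)) ` {F. finite F \<and> F \<subseteq> {0..}}.
      pointwise_le X g k \<and> pointwise_le X h k"
    by (intro bexI[of _ "step_map X (F \<union> G) (level X f)"]) (auto intro: step_map_mono)
qed auto

section \<open>Scott-openness of the subbasic compact-open sets\<close>

lemma supremum_lsc_eq:
  assumes D: "D \<subseteq> lsc_maps X" and s: "supremum_in (lsc_maps X) (pointwise_le X) D s"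
    and x: "x \<in> topspace X"
  shows "s x = (SUP f\<in>D. f x)"
proof (rule antisym)
  define g where "g = (\<lambda>x\<in>topspace X. SUP f\<in>D. f x)"
  \<comment> \<open>Superlevel sets of a pointwise supremum are unions of superlevel sets, so
    \<open>g\<close> competes with \<open>s\<close> as an upper bound.\<close>
  have "{x \<in> topspace X. t < g x} = (\<Union>f\<in>D. {x \<in> topspace X. t < f x})" for t
    by (auto simp: g_def less_SUP_iff)
  moreover have "openin X (\<Union>f\<in>D. {x \<in> topspace X. t < f x})" for t
    using D by (intro openin_Union) (auto simp: lsc_maps_iff)
  moreover have "g \<in> extensional (topspace X)" by (simp add: g_def)
  ultimately have "g \<in> lsc_maps X"
    by (simp add: lsc_maps_iff)
  moreover have "pointwise_le X f g" if "f \<in> D" for f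
    using that by (auto simp: pointwise_le_def g_def intro: SUP_upper)
  ultimately have "pointwise_le X s g"
    using s unfolding supremum_in_def by blast
  then show "s x \<le> (SUP f\<in>D. f x)" using x by (simp add: pointwise_le_def g_def)
  show "(SUP f\<in>D. f x) \<le> s x"
    using s x by (auto simp: supremum_in_def pointwise_le_def intro: SUP_least)
qed

text \<open>For a directed family with supremum in the set, the level sets at \<open>a\<close> cover
  \<open>Q\<close>; a finite subcover and directedness then give a single member whose level set
  contains \<open>Q\<close>.\<close>

lemma compact_open_subbasic_scott_open:
  assumes Q: "compactin X Q"
  shows "scott_open (lsc_maps X) (pointwise_le X)
           {f \<in> lsc_maps X. \<forall>x\<in>Q. ereal a < enn2ereal (f x)}" (is "scott_open _ _ ?W")
  unfolding scott_open_def
proof (intro conjI allI impI)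
  have QX: "Q \<subseteq> topspace X" using Q compactin_subset_topspace by blast
  show "\<forall>f\<in>?W. \<forall>g\<in>lsc_maps X. pointwise_le X f g \<longrightarrow> g \<in> ?W"
    using QX by (auto simp: pointwise_le_def less_eq_ennreal.rep_eq intro: less_le_trans)
  fix D s assume D: "directed_in (lsc_maps X) (pointwise_le X) D \<and>
    supremum_in (lsc_maps X) (pointwise_le X) D s \<and> s \<in> ?W"
  then have DL: "D \<subseteq> lsc_maps X" and "D \<noteq> {}" by (auto simp: directed_in_def)
  show "D \<inter> ?W \<noteq> {}"
  proof (cases "a < 0")
    \<comment> \<open>A negative threshold imposes no condition; it is split off because
      \<open>ennreal a\<close> would turn it into 0.\<close>
    case True
    then have "ereal a < enn2ereal y" for y
      by (metis enn2ereal_nonneg ereal_less(2) ereal_less_eq(5) less_le_trans linorder_not_le)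
    then show ?thesis using DL \<open>D \<noteq> {}\<close> by auto
  next
    case False
    then have a: "ereal a < enn2ereal y \<longleftrightarrow> ennreal a < y" for y
      by (simp add: less_ennreal.rep_eq)
    have "Q \<subseteq> \<Union>((\<lambda>f. level X f a) ` D)"
    proof
      fix x assume "x \<in> Q"
      then have "x \<in> topspace X" "ennreal a < s x" using QX D a by auto
      then show "x \<in> \<Union>((\<lambda>f. level X f a) ` D)"
        using supremum_lsc_eq[OF DL conjunct1[OF conjunct2[OF D]]] by (auto simp: less_SUP_iff level_def)
    qed
    moreover have "\<forall>U\<in>(\<lambda>f. level X f a) ` D. openin X U"
      using DL openin_level by blast
    ultimately obtain \<F> where "finite \<F>" "\<F> \<subseteq> (\<lambda>f. level X f a) ` D" "Q \<subseteq> \<Union>\<F>"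
      using Q unfolding compactin_def by meson
    then obtain E where E: "finite E" "E \<subseteq> D" "Q \<subseteq> \<Union>((\<lambda>f. level X f a) ` E)"
      by (metis finite_subset_image)
    have "\<exists>g\<in>D. \<forall>f\<in>E. pointwise_le X f g"
      using E(1,2)
    proof (induction E rule: finite_induct)
      case empty
      then show ?case using \<open>D \<noteq> {}\<close> by auto
    next
      case (insert f E)
      then obtain g where g: "g \<in> D" "\<forall>f\<in>E. pointwise_le X f g" by auto
      then obtain k where "k \<in> D" "pointwise_le X f k" "pointwise_le X g k"
        using D insert.prems unfolding directed_in_def by blast
      with g show ?case
        unfolding pointwise_le_def by (metis insert_iff order_trans)
    qed
    then obtain g where g: "g \<in> D" "\<forall>f\<in>E. pointwise_le X f g" by blast
    have "ennreal a < g x" if "x \<in> Q" for x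
      using E(3) that g(2) by (force simp: level_def pointwise_le_def)
    then show ?thesis using g DL a by auto
  qed
qed auto

section \<open>Fibres of compact saturated subsets of a coproduct\<close>

lemma compactin_sum_topology_fibre:
  assumes Q: "compactin (sum_topology X I) Q" and i: "i \<in> I"
  shows "compactin (X i) {x. (i, x) \<in> Q}"
  unfolding compactin_def
proof (intro conjI allI impI)
  show "{x. (i, x) \<in> Q} \<subseteq> topspace (X i)"
    using compactin_subset_topspace[OF Q] by auto
  fix \<U> assume \<U>: "(\<forall>U\<in>\<U>. openin (X i) U) \<and> {x. (i, x) \<in> Q} \<subseteq> \<Union>\<U>"
  define R where "R = Sigma (I - {i}) (topspace \<circ> X)"
  have "openin (sum_topology X I) (Pair i ` U)" if "U \<in> \<U>" for U
  proof -
    have "{x. (j, x) \<in> Pair i ` U} = (if j = i then U else {})" for j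
      by auto
    then show ?thesis
      using that \<U> i openin_subset by (fastforce simp: openin_sum_topology)
  qed
  moreover have "openin (sum_topology X I) R"
  proof -
    have "{x. (j, x) \<in> R} = (if j \<in> I - {i} then topspace (X j) else {})" for j
      by (auto simp: R_def)
    then show ?thesis
      by (simp add: openin_sum_topology) (auto simp: R_def)
  qed
  moreover have "Q \<subseteq> \<Union>(insert R ((`) (Pair i) ` \<U>))"
  proof
    fix p assume "p \<in> Q"
    moreover obtain j x where p: "p = (j, x)" by force
    ultimately have "j \<in> I" "x \<in> topspace (X j)" 
      using compactin_subset_topspace[OF Q] by auto
    show "p \<in> \<Union>(insert R ((`) (Pair i) ` \<U>))"
    proof (cases "j = i")
      case True
      then obtain U where "U \<in> \<U>" "x \<in> U" using \<open>p \<in> Q\<close> p \<U> by blast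
      then show ?thesis using True p by blast
    next
      case False
      then show ?thesis using \<open>j \<in> I\<close> \<open>x \<in> topspace (X j)\<close> p by (simp add: R_def)
    qed
  qed
  ultimately have "\<exists>\<F>. finite \<F> \<and> \<F> \<subseteq> insert R ((`) (Pair i) ` \<U>) \<and> Q \<subseteq> \<Union>\<F>"
    by (intro Q[unfolded compactin_def, THEN conjunct2, rule_format]) auto
  then obtain \<F> where \<F>: "finite \<F>" "\<F> \<subseteq> insert R ((`) (Pair i) ` \<U>)" "Q \<subseteq> \<Union>\<F>"
    by blast
  then have "finite (\<F> - {R})" "\<F> - {R} \<subseteq> (`) (Pair i) ` \<U>" by auto
  then obtain \<G> where \<G>: "\<G> \<subseteq> \<U>" "finite \<G>" "\<F> - {R} = (`) (Pair i) ` \<G>"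
    by (metis finite_subset_image)
  have "{x. (i, x) \<in> Q} \<subseteq> \<Union>\<G>"
  proof
    fix x assume "x \<in> {x. (i, x) \<in> Q}"
    moreover have "(i, x) \<notin> R" by (simp add: R_def)
    ultimately have "(i, x) \<in> \<Union>(\<F> - {R})" using \<F>(3) by auto
    then show "x \<in> \<Union>\<G>" unfolding \<G>(3) by auto
  qed
  then show "\<exists>\<F>. finite \<F> \<and> \<F> \<subseteq> \<U> \<and> {x. (i, x) \<in> Q} \<subseteq> \<Union>\<F>"
    using \<G> by blast
qed

lemma saturated_in_sum_topology_fibre:
  assumes Q: "saturated_in (sum_topology X I) Q" and i: "i \<in> I"
  shows "saturated_in (X i) {x. (i, x) \<in> Q}"
proof -
  obtain \<V> where \<V>: "\<forall>V\<in>\<V>. openin (sum_topology X I) V"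
    "Q = topspace (sum_topology X I) \<inter> \<Inter>\<V>"
    using Q unfolding saturated_in_def by blast
  then show ?thesis
    unfolding saturated_in_def using i
    by (intro exI[of _ "(\<lambda>V. {x. (i, x) \<in> V}) ` \<V>"]) (auto simp: openin_sum_topology)
qed

text \<open>Membership of a step map in \<open>\<W>\<close> depends on all its sets jointly, so the
  compact sets for the thresholds have to be found simultaneously; a single compact set of the
  coproduct provides them.\<close>

lemma compact_open_neighbourhood:
  assumes X: "odot_consonant X"
    and \<W>: "scott_open (lsc_maps X) (pointwise_le X) \<W>" and f: "f \<in> \<W>"
  shows "\<exists>N. openin (compact_open_topology X) N \<and> f \<in> N \<and> N \<subseteq> \<W>"
proof -
  have fL: "f \<in> lsc_maps X" using \<W> f by (auto simp: scott_open_def)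
  have \<W>_up: "h \<in> \<W>" if "g \<in> \<W>" "h \<in> lsc_maps X" "pointwise_le X g h" for g h
    using \<W> that by (auto simp: scott_open_def)
  obtain F where F: "finite F" "F \<subseteq> {0..}" and fF: "step_map X F (level X f) \<in> \<W>"
    using \<W> f supremum_step_maps[OF fL] directed_step_maps[OF fL] unfolding scott_open_def by blast
  define n where "n = card F"
  obtain idx where idx: "bij_betw idx F {..<n}"
    using ex_bij_betw_finite_nat[OF F(1)] by (auto simp: n_def atLeast0LessThan)
  define S where "S = sum_topology (\<lambda>_. X) {..<n}"
  have S: "consonant S" using X by (simp add: odot_consonant_def S_def)
  have idx_less: "idx r \<in> {..<n}" if "r \<in> F" for r using idx that by (rule bij_betw_apply)
  \<comment> \<open>\<open>\<phi>\<close> decodes an open set of the coproduct into a step map,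
    summand \<open>idx r\<close> giving the set for threshold \<open>r\<close>. It is monotone and
    preserves directed suprema, which makes \<open>\<U>\<close> Scott-open.\<close>
  define \<phi> where "\<phi> O' = step_map X F (\<lambda>r. {x. (idx r, x) \<in> O'})" for O'
  have \<phi>_lsc: "\<phi> O' \<in> lsc_maps X" if "openin S O'" for O'
    unfolding \<phi>_def by (rule step_map_lsc) (use that idx_less in \<open>auto simp: S_def openin_sum_topology\<close>)
  have \<phi>_mono: "pointwise_le X (\<phi> O') (\<phi> O'')" if "O' \<subseteq> O''" for O' O''
    unfolding \<phi>_def by (rule step_map_mono) (use that in auto)
  define \<U> where "\<U> = {O'. openin S O' \<and> \<phi> O' \<in> \<W>}"
  have \<U>: "scott_open {V. openin S V} (\<subseteq>) \<U>"
    unfolding scott_open_def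
  proof (intro conjI allI impI)
    show "\<forall>O'\<in>\<U>. \<forall>O''\<in>{V. openin S V}. O' \<subseteq> O'' \<longrightarrow> O'' \<in> \<U>"
      using \<W>_up \<phi>_lsc \<phi>_mono unfolding \<U>_def by blast
    fix \<D> s
    assume \<D>: "directed_in {V. openin S V} (\<subseteq>) \<D> \<and> supremum_in {V. openin S V} (\<subseteq>) \<D> s \<and> s \<in> \<U>"
    then have "\<forall>O'\<in>\<D>. openin S O'" by (auto simp: directed_in_def)
    then have "s \<subseteq> \<Union>\<D>"
      using \<D> unfolding supremum_in_def by (metis (mono_tags, lifting) Union_upper mem_Collect_eq openin_Union)
    have dir: "directed_in (lsc_maps X) (pointwise_le X) (\<phi> ` \<D>)"
      unfolding directed_in_def
    proof (intro conjI ballI)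
      show "\<phi> ` \<D> \<subseteq> lsc_maps X" "\<phi> ` \<D> \<noteq> {}"
        using \<D> \<phi>_lsc unfolding directed_in_def by auto
      fix g h assume "g \<in> \<phi> ` \<D>" "h \<in> \<phi> ` \<D>"
      then obtain A B where AB: "A \<in> \<D>" "g = \<phi> A" "B \<in> \<D>" "h = \<phi> B" by blast
      then obtain C where "C \<in> \<D>" "A \<subseteq> C" "B \<subseteq> C" using \<D> unfolding directed_in_def by metis
      with AB \<phi>_mono show "\<exists>k\<in>\<phi> ` \<D>. pointwise_le X g k \<and> pointwise_le X h k" by blast
    qed
    \<comment> \<open>Thresholds can be checked one at a time: a point of \<open>s\<close> in
      summand \<open>idx r\<close> already lies in some member of \<open>\<D>\<close>, so
      \<open>u\<close> reaches \<open>r\<close> there.\<close>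
    have sup: "supremum_in (lsc_maps X) (pointwise_le X) (\<phi> ` \<D>) (\<phi> s)"
      unfolding supremum_in_def
    proof (intro conjI ballI impI)
      show "\<phi> s \<in> lsc_maps X" using \<D> \<phi>_lsc by (auto simp: \<U>_def)
      show "pointwise_le X g (\<phi> s)" if "g \<in> \<phi> ` \<D>" for g
        using that \<D> \<phi>_mono unfolding supremum_in_def by blast
      fix u assume u: "\<forall>g\<in>\<phi> ` \<D>. pointwise_le X g u"
      show "pointwise_le X (\<phi> s) u"
        unfolding pointwise_le_def
      proof
        fix x assume x: "x \<in> topspace X"
        have "ennreal r \<le> u x" if r: "r \<in> F" "(idx r, x) \<in> s" for r
        proof -
          obtain O' where O': "O' \<in> \<D>" "(idx r, x) \<in> O'" using r \<open>s \<subseteq> \<Union>\<D>\<close> by auto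
          then have "ennreal r \<le> \<phi> O' x" unfolding \<phi>_def using r x by (intro le_step_map) auto
          also have "\<dots> \<le> u x" using u O' x by (auto simp: pointwise_le_def)
          finally show ?thesis .
        qed
        then show "\<phi> s x \<le> u x" unfolding \<phi>_def by (simp add: step_map_le_iff x)
      qed
    qed
    have "\<phi> ` \<D> \<inter> \<W> \<noteq> {}"
      using \<W> dir sup \<D> unfolding scott_open_def \<U>_def by blast
    then show "\<D> \<inter> \<U> \<noteq> {}"
      using \<open>\<forall>O'\<in>\<D>. openin S O'\<close> by (auto simp: \<U>_def)
  qed (auto simp: \<U>_def)
  \<comment> \<open>Conversely, a map is encoded by its level sets, spread over the summands;
    injectivity of \<open>idx\<close> keeps distinct thresholds apart.\<close>
  define levels where "levels h = {(i, x). \<exists>r\<in>F. i = idx r \<and> x \<in> level X h r}" for h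
  have fibre: "{x. (idx r, x) \<in> levels h} = level X h r" if "r \<in> F" for r h
    using idx that by (auto simp: levels_def bij_betw_def inj_on_def)
  have levels_open: "openin S (levels h)" if "h \<in> lsc_maps X" for h
    unfolding S_def openin_sum_topology
  proof (intro conjI ballI)
    show "levels h \<subseteq> Sigma {..<n} (topspace \<circ> (\<lambda>_. X))"
      using idx_less by (auto simp: levels_def level_def)
    fix i assume "i \<in> {..<n}"
    then obtain r where "r \<in> F" "i = idx r" using idx by (auto simp: bij_betw_def)
    then show "openin X {x. (i, x) \<in> levels h}" using fibre openin_level that by metis
  qed
  have \<phi>_levels: "\<phi> (levels h) = step_map X F (level X h)" for h
    unfolding \<phi>_def step_map_def by (intro restrict_ext SUP_cong) (simp_all only: fibre)
  have "levels f \<in> \<U>"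
    using fF levels_open[OF fL] by (simp add: \<U>_def \<phi>_levels)
  then obtain Q where Q: "compactin S Q" "saturated_in S Q" "Q \<subseteq> levels f"
    "\<And>V. openin S V \<Longrightarrow> Q \<subseteq> V \<Longrightarrow> V \<in> \<U>"
    using S \<U> unfolding consonant_def by metis
  define Qr where "Qr r = {x. (idx r, x) \<in> Q}" for r
  define B where "B r = {h \<in> lsc_maps X. \<forall>x\<in>Qr r. ereal r < enn2ereal (h x)}" for r
  \<comment> \<open>The factor \<open>topspace\<close> matters when \<open>F\<close> is empty, where
    the intersection over \<open>F\<close> is the universe.\<close>
  define N where "N = topspace (compact_open_topology X) \<inter> (\<Inter>r\<in>F. B r)"
  have QX: "Qr r \<subseteq> topspace X" for r
    using compactin_subset_topspace[OF Q(1)] by (auto simp: Qr_def S_def)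
  \<comment> \<open>Thresholds in \<open>F\<close> are non-negative, so the comparison in
    \<open>ereal\<close> agrees with the one in \<open>ennreal\<close>.\<close>
  have less_iff: "ereal r < enn2ereal y \<longleftrightarrow> ennreal r < y" if "r \<in> F" for r y
    using F(2) that by (auto simp: less_ennreal.rep_eq)
  have "openin (compact_open_topology X) (B r)" if "r \<in> F" for r
    unfolding compact_open_topology_def
  proof (rule topology_generated_by_Basis)
    have "compactin X (Qr r)" "saturated_in X (Qr r)"
      using compactin_sum_topology_fibre[OF Q(1)[unfolded S_def] idx_less]
        saturated_in_sum_topology_fibre[OF Q(2)[unfolded S_def] idx_less] that
      by (simp_all add: Qr_def)
    then show "B r \<in> {{f \<in> lsc_maps X. \<forall>x\<in>Q. ereal a < enn2ereal (f x)} | Q a.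
        compactin X Q \<and> saturated_in X Q}"
      unfolding B_def by blast
  qed
  then have "openin (compact_open_topology X) N"
    unfolding N_def using F(1) by (cases "F = {}") (auto intro!: openin_Int openin_INT)
  moreover have "f \<in> N"
  proof -
    have "ennreal r < f x" if "r \<in> F" "x \<in> Qr r" for r x
      using that Q(3) fibre[of r f] by (auto simp: Qr_def level_def)
    then show ?thesis
      using fL less_iff by (auto simp: N_def B_def topspace_compact_open_topology)
  qed
  moreover have "N \<subseteq> \<W>"
  proof
    fix h assume h: "h \<in> N"
    then have hL: "h \<in> lsc_maps X" by (simp add: N_def topspace_compact_open_topology)
    have "Q \<subseteq> levels h"
    proof
      fix p assume p: "p \<in> Q"
      then obtain r x where r: "r \<in> F" "p = (idx r, x)"
        using Q(3) by (auto simp: levels_def)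
      then have "x \<in> Qr r" using p by (simp add: Qr_def)
      then have "x \<in> level X h r"
        using h r(1) QX less_iff by (auto simp: N_def B_def level_def)
      then show "p \<in> levels h" using r by (auto simp: levels_def)
    qed
    \<comment> \<open>\<open>levels h\<close> is an open neighbourhood of \<open>Q\<close>, so the
      step map it decodes to is in \<open>\<W>\<close>; \<open>h\<close> lies above that step
      map.\<close>
    then have "levels h \<in> \<U>" by (intro Q(4) levels_open hL)
    then have "step_map X F (level X h) \<in> \<W>" by (simp add: \<U>_def \<phi>_levels)
    then show "h \<in> \<W>" using \<W>_up hL step_map_level_le by metis
  qed
  ultimately show ?thesis by blast
qed

lemma compact_open_eq_lsc_scott:
  assumes X: "odot_consonant X"
  shows "compact_open_topology X = lsc_scott_topology X"
  unfolding topology_eq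
proof (intro allI iffI)
  fix W assume W: "openin (compact_open_topology X) W"
  show "openin (lsc_scott_topology X) W"
    unfolding lsc_scott_topology_def openin_scott_topology
  proof (rule generate_topology_on_coarsest)
    show "generate_topology_on {{f \<in> lsc_maps X. \<forall>x\<in>Q. ereal a < enn2ereal (f x)} | Q (a::real).
        compactin X Q \<and> saturated_in X Q} W"
      using W by (simp add: compact_open_topology_def openin_topology_generated_by_iff)
  next
    fix S assume "S \<in> {{f \<in> lsc_maps X. \<forall>x\<in>Q. ereal a < enn2ereal (f x)} | Q (a::real).
        compactin X Q \<and> saturated_in X Q}"
    then show "scott_open (lsc_maps X) (pointwise_le X) S"
      using compact_open_subbasic_scott_open by blast
  qed (rule istopology_scott_open)
next
  fix W assume "openin (lsc_scott_topology X) W"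
  then have "scott_open (lsc_maps X) (pointwise_le X) W"
    by (simp add: lsc_scott_topology_def)
  then show "openin (compact_open_topology X) W"
    using compact_open_neighbourhood[OF X] by (intro iffD2[OF openin_subopen] ballI) blast
qed

section \<open>G-delta subsets of continuous dcpos\<close>

lemma scott_open_inaccessible:
  "\<lbrakk>scott_open P le U; directed_in P le D; supremum_in P le D s; s \<in> U\<rbrakk> \<Longrightarrow> D \<inter> U \<noteq> {}"
  unfolding scott_open_def by blast

text \<open>Koenig's lemma; \<open>desc k n x\<close> says that \<open>x\<close> has descendants \<open>k\<close> levels down.\<close>

lemma koenig_chain:
  assumes fin: "\<And>n. finite (F n)" and ne: "\<And>n. F n \<noteq> {}"
    and parent: "\<And>n y. y \<in> F (Suc n) \<Longrightarrow> \<exists>x\<in>F n. R x y"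
  shows "\<exists>c. \<forall>n. c n \<in> F n \<and> R (c n) (c (Suc n))"
proof -
  define desc where "desc = rec_nat (\<lambda>n x. x \<in> F n)
    (\<lambda>k d n x. x \<in> F n \<and> (\<exists>y\<in>F (Suc n). R x y \<and> d (Suc n) y))"
  have desc_0: "desc 0 n x \<longleftrightarrow> x \<in> F n"
    and desc_Suc: "desc (Suc k) n x \<longleftrightarrow> x \<in> F n \<and> (\<exists>y\<in>F (Suc n). R x y \<and> desc k (Suc n) y)"
    for k n x by (simp_all add: desc_def)
  have desc_F: "x \<in> F n" if "desc k n x" for k n x
    using that by (cases k) (auto simp: desc_0 desc_Suc)
  have desc_SucD: "desc k n x" if "desc (Suc k) n x" for k n x
    using that
  proof (induction k arbitrary: n x)
    case (Suc k)
    from Suc.prems obtain y where "x \<in> F n" "y \<in> F (Suc n)" "R x y" "desc (Suc k) (Suc n) y"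
      unfolding desc_Suc[of "Suc k"] by blast
    with Suc.IH show ?case unfolding desc_Suc[of k] by blast
  qed (auto simp: desc_0 desc_Suc)
  have desc_le: "desc j n x" if "desc k n x" "j \<le> k" for j k n x
    using that(2,1) by (induction rule: inc_induct) (auto intro: desc_SucD)
  have desc_ex: "\<exists>x. desc k n x" for k n
  proof (induction k arbitrary: n)
    case 0
    then show ?case using ne by (auto simp: desc_0)
  next
    case (Suc k)
    then obtain y where "desc k (Suc n) y" by blast
    then show ?case using desc_F parent unfolding desc_Suc by blast
  qed
  \<comment> \<open>Among finitely many candidates one has descendants at all depths: otherwise each
    \<open>x\<close> runs out at some depth \<open>K x\<close>, and the maximum of these depths
    contradicts \<open>ex\<close>.\<close>
  have bound: "\<exists>x\<in>A. \<forall>k. desc k n x" if "finite A" and ex: "\<And>k. \<exists>x\<in>A. desc k n x" for A n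
  proof (rule ccontr)
    assume "\<not> ?thesis"
    then obtain K where K: "\<And>x. x \<in> A \<Longrightarrow> \<not> desc (K x) n x" by metis
    obtain x where "x \<in> A" "desc (Max (K ` A)) n x" using ex by blast
    with K desc_le \<open>finite A\<close> show False by (meson Max_ge finite_imageI imageI)
  qed
  have "\<exists>c. \<forall>n. (\<forall>k. desc k n (c n)) \<and> R (c n) (c (Suc n))"
  proof (rule dependent_nat_choice)
    show "\<exists>x. \<forall>k. desc k 0 x"
      using bound[of "F 0" 0] fin desc_ex desc_F by metis
    fix x n assume x: "\<forall>k. desc k n x"
    have "\<exists>y\<in>{y \<in> F (Suc n). R x y}. \<forall>k. desc k (Suc n) y"
    proof (rule bound)
      show "\<exists>y\<in>{y \<in> F (Suc n). R x y}. desc k (Suc n) y" for k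
        using x desc_Suc[of k n x] by blast
    qed (use fin in auto)
    then show "\<exists>y. (\<forall>k. desc k (Suc n) y) \<and> R x y" by blast
  qed
  then show ?thesis using desc_F by meson
qed

section \<open>The way-below relation of a continuous dcpo\<close>

locale continuous_dcpo =
  fixes P :: "'a set" and le :: "'a \<Rightarrow> 'a \<Rightarrow> bool"
  assumes refl: "x \<in> P \<Longrightarrow> le x x"
    and trans: "\<lbrakk>x \<in> P; y \<in> P; z \<in> P; le x y; le y z\<rbrakk> \<Longrightarrow> le x z"
    and continuous: "continuous_dcpo_on P le"
begin

abbreviation wb :: "'a \<Rightarrow> 'a \<Rightarrow> bool" where "wb \<equiv> way_below P le"

lemma directed_wb: "y \<in> P \<Longrightarrow> directed_in P le {x \<in> P. wb x y}"
  and supremum_wb: "y \<in> P \<Longrightarrow> supremum_in P le {x \<in> P. wb x y} y"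
  using continuous by (simp_all add: continuous_dcpo_on_def)

lemma singleton_directed: "y \<in> P \<Longrightarrow> directed_in P le {y}"
  and singleton_supremum: "y \<in> P \<Longrightarrow> supremum_in P le {y} y"
  by (auto simp: directed_in_def supremum_in_def refl)

lemma wb_imp_le: "\<lbrakk>y \<in> P; wb x y\<rbrakk> \<Longrightarrow> le x y"
  unfolding way_below_def using singleton_directed singleton_supremum refl by blast

lemma wb_le_trans: "\<lbrakk>y \<in> P; z \<in> P; wb x y; le y z\<rbrakk> \<Longrightarrow> wb x z"
  unfolding way_below_def directed_in_def
proof (intro allI impI)
  fix D s
  assume yz: "y \<in> P" "z \<in> P" "le y z"
    and wb: "\<forall>D s. (D \<subseteq> P \<and> D \<noteq> {} \<and> (\<forall>x\<in>D. \<forall>y\<in>D. \<exists>z\<in>D. le x z \<and> le y z)) \<and>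
           supremum_in P le D s \<and> le y s \<longrightarrow> (\<exists>z\<in>D. le x z)"
    and D: "(D \<subseteq> P \<and> D \<noteq> {} \<and> (\<forall>x\<in>D. \<forall>y\<in>D. \<exists>z\<in>D. le x z \<and> le y z)) \<and>
           supremum_in P le D s \<and> le z s"
  then have "s \<in> P" by (simp add: supremum_in_def)
  then have "le y s" using trans yz D by blast
  then show "\<exists>z\<in>D. le x z" using wb D by blast
qed

lemma le_wb_trans:
  assumes "x \<in> P" "y \<in> P" "le x y" "wb y z"
  shows "wb x z"
  unfolding way_below_def
proof (intro allI impI)
  fix D s assume D: "directed_in P le D \<and> supremum_in P le D s \<and> le z s"
  then obtain d where "d \<in> D" "le y d" using assms(4) unfolding way_below_def by blast
  moreover then have "d \<in> P" using D by (auto simp: directed_in_def)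
  ultimately show "\<exists>d\<in>D. le x d" using trans assms by blast
qed

text \<open>The elements two way-below steps under \<open>y\<close> form a directed set
  \<open>D\<close> whose supremum is still \<open>y\<close>; so \<open>x\<close>, being way below
  \<open>y\<close>, lies under a member of \<open>D\<close>.\<close>

lemma interpolation:
  assumes x: "x \<in> P" and y: "y \<in> P" and xy: "wb x y"
  shows "\<exists>w\<in>P. wb x w \<and> wb w y"
proof -
  define D where "D = {z \<in> P. \<exists>w\<in>P. wb z w \<and> wb w y}"
  have up: "\<exists>z\<in>P. wb z v \<and> le a z \<and> le b z" if "v \<in> P" "a \<in> P" "b \<in> P" "wb a v" "wb b v" for a b v
    using directed_wb[OF that(1)] that unfolding directed_in_def by blast
  have below: "\<exists>z\<in>P. wb z v" if "v \<in> P" for v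
    using directed_wb[OF that] unfolding directed_in_def by blast
  have "directed_in P le D"
    unfolding directed_in_def
  proof (intro conjI ballI)
    show "D \<noteq> {}" using below y unfolding D_def by blast
    fix a b assume "a \<in> D" "b \<in> D"
    then obtain v w where vw: "a \<in> P" "b \<in> P" "v \<in> P" "w \<in> P" "wb a v" "wb b w" "wb v y" "wb w y"
      unfolding D_def by blast
    then obtain u where u: "u \<in> P" "wb u y" "le v u" "le w u" using up[OF y] by blast
    then have "wb a u" "wb b u" using vw wb_le_trans by blast+
    then obtain z where "z \<in> P" "wb z u" "le a z" "le b z" using up vw u by blast
    then show "\<exists>z\<in>D. le a z \<and> le b z" using u unfolding D_def by blast
  qed (auto simp: D_def)
  moreover have "supremum_in P le D y"
    unfolding supremum_in_def
  proof (intro conjI ballI impI)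
    show "le z y" if "z \<in> D" for z
      using that y trans wb_imp_le unfolding D_def by blast
    fix u assume u: "u \<in> P" "\<forall>z\<in>D. le z u"
    have "le w u" if "w \<in> {w \<in> P. wb w y}" for w
    proof -
      have "le z u" if "z \<in> {z \<in> P. wb z w}" for z
        using that u \<open>w \<in> _\<close> unfolding D_def by blast
      then show ?thesis using supremum_wb[of w] that u(1) unfolding supremum_in_def by blast
    qed
    then show "le y u" using supremum_wb[OF y] u(1) unfolding supremum_in_def by blast
  qed (fact y)
  ultimately obtain z where "z \<in> D" "le x z"
    using xy refl[OF y] unfolding way_below_def by blast
  then show ?thesis using le_wb_trans x unfolding D_def by blast
qed

text \<open>Formed with the way-below relation rather than with \<open>le\<close>, so that it is
  Scott-open.\<close>

definition up :: "'a set \<Rightarrow> 'a set" where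
  "up E = {y \<in> P. \<exists>x\<in>E. wb x y}"

text \<open>Once \<open>w\<close> is interpolated between \<open>x\<close> and the supremum
  \<open>s\<close>, some member of the directed set lies above \<open>w\<close>, and
  \<open>x\<close> is way below that member.\<close>

lemma scott_open_up:
  assumes "E \<subseteq> P"
  shows "scott_open P le (up E)"
  unfolding scott_open_def
proof (intro conjI allI impI)
  show "\<forall>x\<in>up E. \<forall>y\<in>P. le x y \<longrightarrow> y \<in> up E"
    using wb_le_trans by (auto simp: up_def)
  fix D s assume D: "directed_in P le D \<and> supremum_in P le D s \<and> s \<in> up E"
  then obtain x where x: "x \<in> E" "wb x s" "s \<in> P" by (auto simp: up_def)
  then obtain w where w: "w \<in> P" "wb x w" "wb w s" using interpolation assms by blast
  then obtain d where d: "d \<in> D" "le w d" using D refl x(3) unfolding way_below_def by blast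
  then have "d \<in> P" using D by (auto simp: directed_in_def)
  then show "D \<inter> up E \<noteq> {}" using wb_le_trans[OF w(1) _ w(2) d(2)] x d by (auto simp: up_def)
qed (auto simp: up_def)

lemma scott_open_wb:
  assumes "scott_open P le W" "y \<in> W"
  shows "\<exists>x\<in>W. wb x y"
proof -
  have "y \<in> P" using assms by (auto simp: scott_open_def)
  then have "{x \<in> P. wb x y} \<inter> W \<noteq> {}"
    using assms directed_wb supremum_wb unfolding scott_open_def by blast
  then show ?thesis by blast
qed

lemma scott_open_le: "\<lbrakk>scott_open P le W; x \<in> W; y \<in> P; le x y\<rbrakk> \<Longrightarrow> y \<in> W"
  by (auto simp: scott_open_def)

lemma up_subset_scott_open: "\<lbrakk>scott_open P le W; E \<subseteq> W\<rbrakk> \<Longrightarrow> up E \<subseteq> W"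
  unfolding up_def using wb_imp_le scott_open_le by blast

lemma chain_le:
  assumes c: "\<And>n. c n \<in> P" "\<And>n. le (c n) (c (Suc n))" and "m \<le> n"
  shows "le (c m) (c n)"
  using \<open>m \<le> n\<close>
proof (induction rule: dec_induct)
  case base
  show ?case using refl c(1) .
next
  case (step n)
  show ?case using trans[OF c(1) c(1) c(1) step.IH c(2)] .
qed

lemma chain_supremum:
  assumes c: "\<And>n. c n \<in> P" "\<And>n. le (c n) (c (Suc n))"
  shows "\<exists>s. directed_in P le (range c) \<and> supremum_in P le (range c) s"
proof -
  have "directed_in P le (range c)"
    unfolding directed_in_def
  proof (intro conjI ballI)
    fix x y assume "x \<in> range c" "y \<in> range c"
    then obtain m n where "x = c m" "y = c n" by blast
    then show "\<exists>z\<in>range c. le x z \<and> le y z"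
      using chain_le[of c m "max m n"] chain_le[of c n "max m n"] c by auto
  qed (use c in auto)
  then show ?thesis using continuous unfolding continuous_dcpo_on_def dcpo_on_def by blast
qed

text \<open>The subspace is given by a map \<open>e\<close> because the d-Scott topology is by
  definition a pullback. The equation for the image of \<open>e\<close> turns a supremum found in
  \<open>P\<close> back into a point of \<open>A\<close>.\<close>

lemma consonant_G_delta:
  assumes V: "\<And>n::nat. scott_open P le (V n)" and e: "e ` A = (\<Inter>n. V n)"
  shows "consonant (pullback_topology A e (scott_topology P le))"
  unfolding consonant_def
proof (intro allI impI)
  let ?Y = "pullback_topology A e (scott_topology P le)"
  define pre where "pre W = e -` W \<inter> A" for W
  have open_iff: "openin ?Y U \<longleftrightarrow> (\<exists>W. scott_open P le W \<and> U = pre W)" for U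
    by (simp add: openin_pullback_topology pre_def)
  have VP: "V n \<subseteq> P" for n using V by (simp add: scott_open_def)
  have eV: "e a \<in> V n" if "a \<in> A" for a n using e that by blast
  have topY: "topspace ?Y = A"
    using eV VP by (force simp: topspace_pullback_topology)
  fix \<U> U assume "scott_open {V. openin ?Y V} (\<subseteq>) \<U> \<and> U \<in> \<U>"
  then have \<U>: "scott_open {V. openin ?Y V} (\<subseteq>) \<U>" and U: "U \<in> \<U>" by auto
  have \<U>_up: "B \<in> \<U>" if "C \<in> \<U>" "openin ?Y B" "C \<subseteq> B" for B C
    using \<U> that by (auto simp: scott_open_def)
  \<comment> \<open>As \<open>e\<close> maps \<open>A\<close> into \<open>V n\<close>, the sets
    \<open>W\<close> and \<open>W \<inter> V n\<close> have the same preimage. By continuity of the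
    dcpo it is the directed union of the sets \<open>pre (up E)\<close>, and Scott-openness of
    \<open>\<U>\<close> selects one of them.\<close>
  have step: "\<exists>E. finite E \<and> E \<subseteq> W \<inter> V n \<and> pre (up E) \<in> \<U>"
    if W: "scott_open P le W" "pre W \<in> \<U>" for W n
  proof -
    let ?\<E> = "{E. finite E \<and> E \<subseteq> W \<inter> V n}"
    have WV: "scott_open P le (W \<inter> V n)"
      using W V istopology_scott_open unfolding istopology_def by blast
    have op: "openin ?Y (pre (up E))" if "E \<in> ?\<E>" for E
      using that VP unfolding open_iff by (metis (no_types, lifting) Int_iff mem_Collect_eq scott_open_up subset_iff)
    have "directed_in {V. openin ?Y V} (\<subseteq>) ((\<lambda>E. pre (up E)) ` ?\<E>)"
      unfolding directed_in_def
    proof (intro conjI ballI)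
      fix B C assume "B \<in> (\<lambda>E. pre (up E)) ` ?\<E>" "C \<in> (\<lambda>E. pre (up E)) ` ?\<E>"
      then obtain E E' where "E \<in> ?\<E>" "E' \<in> ?\<E>" "B = pre (up E)" "C = pre (up E')" by blast
      then show "\<exists>D\<in>(\<lambda>E. pre (up E)) ` ?\<E>. B \<subseteq> D \<and> C \<subseteq> D"
        by (intro bexI[of _ "pre (up (E \<union> E'))"]) (auto simp: pre_def up_def)
    qed (use op in auto)
    moreover have "supremum_in {V. openin ?Y V} (\<subseteq>) ((\<lambda>E. pre (up E)) ` ?\<E>) (pre W)"
      unfolding supremum_in_def
    proof (intro conjI ballI impI)
      show "pre W \<in> {V. openin ?Y V}" using W open_iff by blast
      show "B \<subseteq> pre W" if B: "B \<in> (\<lambda>E. pre (up E)) ` ?\<E>" for B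
      proof -
        obtain E where E: "E \<subseteq> W" "B = pre (up E)" using B by auto
        then have "up E \<subseteq> W" by (intro up_subset_scott_open[OF W(1)])
        then show ?thesis by (auto simp: E pre_def)
      qed
      fix B assume B: "\<forall>C\<in>(\<lambda>E. pre (up E)) ` ?\<E>. C \<subseteq> B"
      show "pre W \<subseteq> B"
      proof
        fix a assume a: "a \<in> pre W"
        then have "e a \<in> W \<inter> V n" using eV by (auto simp: pre_def)
        then obtain x where "x \<in> W \<inter> V n" "wb x (e a)" using scott_open_wb[OF WV] by blast
        then have "{x} \<in> ?\<E>" "a \<in> pre (up {x})"
          using a \<open>e a \<in> W \<inter> V n\<close> VP by (auto simp: pre_def up_def)
        then show "a \<in> B" using B by blast
      qed
    qed
    ultimately have "(\<lambda>E. pre (up E)) ` ?\<E> \<inter> \<U> \<noteq> {}"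
      using \<U> W(2) unfolding scott_open_def by blast
    then show ?thesis by blast
  qed
  have "openin ?Y U" using \<U> U by (auto simp: scott_open_def)
  then obtain W0 where W0: "scott_open P le W0" "U = pre W0" using open_iff by blast
  \<comment> \<open>Each \<open>E n\<close> lies in \<open>V n\<close> and refines the previous one, so that the intersection of the
    \<open>up (E n)\<close> is the required compact set.\<close>
  have "\<exists>E. \<forall>n. (finite (E n) \<and> E n \<subseteq> V n \<and> pre (up (E n)) \<in> \<U> \<and> (n = 0 \<longrightarrow> E n \<subseteq> W0)) \<and>
      E (Suc n) \<subseteq> up (E n)"
  proof (rule dependent_nat_choice)
    \<comment> \<open>Only the first stage is required to lie in \<open>W0\<close>: as
      \<open>Q\<close> is inside \<open>pre (up (E 0))\<close>, this gives
      \<open>Q \<subseteq> U\<close>.\<close>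
    show "\<exists>E. finite E \<and> E \<subseteq> V 0 \<and> pre (up E) \<in> \<U> \<and> (0 = 0 \<longrightarrow> E \<subseteq> W0)"
      using step[OF W0(1), of 0] W0(2) U by blast
    fix E n assume E: "finite E \<and> E \<subseteq> V n \<and> pre (up E) \<in> \<U> \<and> (n = 0 \<longrightarrow> E \<subseteq> W0)"
    then have "scott_open P le (up E)" using scott_open_up VP by blast
    then show "\<exists>E'. (finite E' \<and> E' \<subseteq> V (Suc n) \<and> pre (up E') \<in> \<U> \<and> (Suc n = 0 \<longrightarrow> E' \<subseteq> W0)) \<and>
        E' \<subseteq> up E"
      using step[of "up E" "Suc n"] E by blast
  qed
  then obtain E where fin: "\<And>n. finite (E n)" and EV: "\<And>n. E n \<subseteq> V n"
    and E\<U>: "\<And>n. pre (up (E n)) \<in> \<U>" and E0: "E 0 \<subseteq> W0" and Eup: "\<And>n. E (Suc n) \<subseteq> up (E n)"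
    by metis
  have so: "scott_open P le (up (E n))" for n using scott_open_up EV VP by blast
  define Q where "Q = pre (\<Inter>n. up (E n))"
  have QE: "Q \<subseteq> pre (up (E n))" for n by (auto simp: Q_def pre_def)
  \<comment> \<open>If every \<open>E n\<close> leaves \<open>W\<close>, Koenig's lemma provides an
    ascending chain outside \<open>W\<close>. Its supremum lies in all \<open>V n\<close> and all
    \<open>up (E n)\<close>, so it is the image of a point of \<open>Q\<close> and belongs to
    \<open>W\<close>, which contradicts Scott-openness of \<open>W\<close>.\<close>
  have key: "\<exists>n. E n \<subseteq> W" if W: "scott_open P le W" "Q \<subseteq> pre W" for W
  proof (rule ccontr)
    assume "\<nexists>n. E n \<subseteq> W"
    \<comment> \<open>A parent of a point outside \<open>W\<close> is itself outside
      \<open>W\<close>, because \<open>W\<close> is upwards closed.\<close>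
    moreover have "\<exists>x\<in>E n - W. le x y" if y: "y \<in> E (Suc n) - W" for n y
    proof -
      have "y \<in> P" "y \<in> up (E n)" using y EV VP Eup by blast+
      then obtain x where "x \<in> E n" "wb x y" by (auto simp: up_def)
      then show ?thesis
        using wb_imp_le[OF \<open>y \<in> P\<close>] scott_open_le[OF W(1) _ \<open>y \<in> P\<close>] y by blast
    qed
    ultimately obtain c where c: "\<And>n. c n \<in> E n - W" "\<And>n. le (c n) (c (Suc n))"
      using koenig_chain[of "\<lambda>n. E n - W" le] fin by (metis Diff_eq_empty_iff finite_Diff)
    have cP: "c n \<in> P" for n using c(1) EV VP by blast
    obtain s where s: "directed_in P le (range c)" "supremum_in P le (range c) s"
      using chain_supremum[of c] cP c(2) by blast
    then have sP: "s \<in> P" and cs: "le (c n) s" for n by (auto simp: supremum_in_def)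
    have "s \<in> V n" for n 
    proof (rule scott_open_le[OF V _ sP cs])
      show "c n \<in> V n" using EV c(1)[of n] by auto
    qed
    then obtain a where a: "a \<in> A" "e a = s" using e by (metis INT_I imageE)
    have "s \<in> up (E n)" for n
    proof (rule scott_open_le[OF so _ sP cs])
      show "c (Suc n) \<in> up (E n)" using Eup[of n] c(1)[of "Suc n"] by auto
    qed
    then have "a \<in> Q" using a by (simp add: Q_def pre_def)
    then have "s \<in> W" using W a by (auto simp: pre_def)
    then have "range c \<inter> W \<noteq> {}" using W(1) s unfolding scott_open_def by blast
    then show False using c(1) by blast
  qed
  have "compactin ?Y Q"
    unfolding compactin_def
  proof (intro conjI allI impI)
    show "Q \<subseteq> topspace ?Y" by (auto simp: topY Q_def pre_def)
    fix \<C> assume \<C>: "(\<forall>C\<in>\<C>. openin ?Y C) \<and> Q \<subseteq> \<Union>\<C>"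
    \<comment> \<open>The cover is lifted to Scott-open sets of the dcpo. Finitely many of them
      cover the finite set \<open>E n\<close> given by \<open>key\<close>, hence also
      \<open>up (E n)\<close>, and so their preimages cover \<open>Q\<close>.\<close>
    define \<S> where "\<S> = {W. scott_open P le W \<and> pre W \<in> \<C>}"
    have \<S>_Union: "scott_open P le (\<Union>\<T>)" if "\<T> \<subseteq> \<S>" for \<T>
      using istopology_scott_open[of P le] that unfolding istopology_def \<S>_def by (simp add: subset_iff)
    have "scott_open P le (\<Union>\<S>)" by (rule \<S>_Union) simp
    moreover have "Q \<subseteq> pre (\<Union>\<S>)"
    proof
      fix a assume "a \<in> Q"
      then obtain C where C: "C \<in> \<C>" "a \<in> C" using \<C> by (meson UnionE subsetD)
      then have "openin ?Y C" using \<C> by simp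
      then obtain W where "scott_open P le W" "C = pre W" unfolding open_iff by auto
      then have "W \<in> \<S>" using C by (simp add: \<S>_def)
      then show "a \<in> pre (\<Union>\<S>)" using C \<open>C = pre W\<close> by (auto simp: pre_def)
    qed
    ultimately obtain n where "E n \<subseteq> \<Union>\<S>" using key by blast
    then obtain \<F> where \<F>: "finite \<F>" "\<F> \<subseteq> \<S>" "E n \<subseteq> \<Union>\<F>"
      using finite_subset_Union fin by metis
    have "up (E n) \<subseteq> \<Union>\<F>" using up_subset_scott_open[OF \<S>_Union[OF \<F>(2)] \<F>(3)] .
    then have "Q \<subseteq> \<Union>(pre ` \<F>)" using QE[of n] by (fastforce simp: pre_def)
    then show "\<exists>\<F>. finite \<F> \<and> \<F> \<subseteq> \<C> \<and> Q \<subseteq> \<Union>\<F>"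
      using \<F> unfolding \<S>_def by (intro exI[of _ "pre ` \<F>"]) auto
  qed
  moreover have "saturated_in ?Y Q"
    unfolding saturated_in_def topY
  proof (intro exI[of _ "range (\<lambda>n. pre (up (E n)))"] conjI)
    show "\<forall>V\<in>range (\<lambda>n. pre (up (E n))). openin ?Y V" using so open_iff by blast
  qed (auto simp: Q_def pre_def)
  moreover have "Q \<subseteq> U"
    using QE[of 0] up_subset_scott_open[OF W0(1) E0] by (auto simp: W0 pre_def)
  moreover have "B \<in> \<U>" if B: "openin ?Y B" "Q \<subseteq> B" for B
  proof -
    obtain W where W: "scott_open P le W" "B = pre W" using B(1) unfolding open_iff by auto
    then obtain n where "E n \<subseteq> W" using key[of W] B(2) by auto
    then have "pre (up (E n)) \<subseteq> B"
      using up_subset_scott_open[OF W(1)] W(2) by (auto simp: pre_def)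
    then show ?thesis using \<U>_up[OF E\<U> B(1)] by simp
  qed
  ultimately show "\<exists>Q. compactin ?Y Q \<and> saturated_in ?Y Q \<and> Q \<subseteq> U \<and>
      (\<forall>V. openin ?Y V \<and> Q \<subseteq> V \<longrightarrow> V \<in> \<U>)"
    by blast
qed

end

section \<open>Coproducts of continuous dcpos\<close>

definition sum_le :: "('a \<Rightarrow> 'a \<Rightarrow> bool) \<Rightarrow> 'i \<times> 'a \<Rightarrow> 'i \<times> 'a \<Rightarrow> bool" where
  "sum_le le = (\<lambda>(i, x) (j, y). i = j \<and> le x y)"

lemma sum_le_Pair [simp]: "sum_le le (i, x) (j, y) \<longleftrightarrow> i = j \<and> le x y"
  by (simp add: sum_le_def)

lemma directed_in_fibre:
  assumes "i \<in> I" "directed_in P le D"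
  shows "directed_in (I \<times> P) (sum_le le) (Pair i ` D)"
  unfolding directed_in_def
proof (intro conjI)
  show "Pair i ` D \<subseteq> I \<times> P" "Pair i ` D \<noteq> {}"
    using assms by (auto simp: directed_in_def)
  show "\<forall>p\<in>Pair i ` D. \<forall>q\<in>Pair i ` D. \<exists>r\<in>Pair i ` D. sum_le le p r \<and> sum_le le q r"
    using assms(2) by (simp add: directed_in_def)
qed

text \<open>A non-empty \<open>D\<close> forces every upper bound into summand
  \<open>i\<close>.\<close>

lemma supremum_in_fibre_iff:
  assumes "i \<in> I" "D \<noteq> {}"
  shows "supremum_in (I \<times> P) (sum_le le) (Pair i ` D) p \<longleftrightarrow>
           (\<exists>s. p = (i, s) \<and> supremum_in P le D s)"
proof (cases p)
  case (Pair j s)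
  have ub: "(\<forall>q\<in>Pair i ` D. sum_le le q (k, u)) \<longleftrightarrow> i = k \<and> (\<forall>x\<in>D. le x u)" for k u
    using assms(2) by auto
  have "(\<forall>q\<in>I \<times> P. (\<forall>x\<in>Pair i ` D. sum_le le x q) \<longrightarrow> sum_le le (i, s) q) \<longleftrightarrow>
      (\<forall>u\<in>P. (\<forall>x\<in>D. le x u) \<longrightarrow> le s u)"
    using assms by (simp add: split_paired_Ball_Sigma) blast
  then show ?thesis
    unfolding Pair supremum_in_def ub using assms(1) by auto
qed

text \<open>Two members of a directed set have a common upper bound, which shares its index with
  both. Questions about directed suprema thus reduce to one summand.\<close>

lemma directed_in_sumE:
  assumes "directed_in (I \<times> P) (sum_le le) D"
  obtains i D' where "i \<in> I" "directed_in P le D'" "D = Pair i ` D'"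
proof -
  obtain i x where ix: "(i, x) \<in> D" "i \<in> I"
    using assms unfolding directed_in_def by (metis SigmaE ex_in_conv subsetD)
  have bound: "\<exists>r\<in>D. sum_le le p r \<and> sum_le le q r" if "p \<in> D" "q \<in> D" for p q
    using assms that by (simp add: directed_in_def)
  have fib: "j = i" if jy: "(j, y) \<in> D" for j y
  proof -
    obtain z where "z \<in> D" "sum_le le (i, x) z" "sum_le le (j, y) z"
      using bound[OF ix(1) jy] by auto
    then show ?thesis by (cases z) auto
  qed
  define D' where "D' = {y. (i, y) \<in> D}"
  have D: "D = Pair i ` D'"
  proof (intro equalityI subsetI)
    fix p assume "p \<in> D"
    moreover then have "p = (i, snd p)" using fib[of "fst p" "snd p"] by (simp add: prod_eq_iff)
    ultimately show "p \<in> Pair i ` D'" by (metis D'_def image_eqI mem_Collect_eq)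
  qed (auto simp: D'_def)
  have "directed_in P le D'"
    unfolding directed_in_def
  proof (intro conjI ballI)
    show "D' \<subseteq> P" "D' \<noteq> {}" using assms ix by (auto simp: directed_in_def D'_def)
    fix y z assume "y \<in> D'" "z \<in> D'"
    then obtain w where "w \<in> D" "sum_le le (i, y) w" "sum_le le (i, z) w"
      using bound[of "(i, y)" "(i, z)"] by (auto simp: D'_def)
    then show "\<exists>w\<in>D'. le y w \<and> le z w" by (cases w) (auto simp: D'_def)
  qed
  with ix D that show thesis by blast
qed

lemma way_below_sum_iff:
  assumes refl: "\<And>x. x \<in> P \<Longrightarrow> le x x" and i: "i \<in> I" and y: "y \<in> P"
  shows "way_below (I \<times> P) (sum_le le) (j, x) (i, y) \<longleftrightarrow> j = i \<and> way_below P le x y"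
proof
  assume wb: "way_below (I \<times> P) (sum_le le) (j, x) (i, y)"
  have ex: "j = i \<and> (\<exists>z\<in>D. le x z)"
    if D: "directed_in P le D" "supremum_in P le D s" "le y s" for D s
  proof -
    have "D \<noteq> {}" using D by (auto simp: directed_in_def)
    then have "supremum_in (I \<times> P) (sum_le le) (Pair i ` D) (i, s)"
      using D(2) by (simp add: supremum_in_fibre_iff[OF i])
    then have "\<exists>z\<in>Pair i ` D. sum_le le (j, x) z"
      using wb directed_in_fibre[OF i D(1)] D(3) sum_le_Pair[of le i y i s]
      unfolding way_below_def by blast
    then show ?thesis by auto
  qed
  \<comment> \<open>\<open>ex\<close> yields \<open>j = i\<close> only in the presence of a test
    family; the singleton \<open>{y}\<close> is one.\<close>
  have "directed_in P le {y}" "supremum_in P le {y} y"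
    using refl y by (auto simp: directed_in_def supremum_in_def)
  with ex refl y show "j = i \<and> way_below P le x y"
    unfolding way_below_def by blast
next
  assume wb: "j = i \<and> way_below P le x y"
  show "way_below (I \<times> P) (sum_le le) (j, x) (i, y)"
    unfolding way_below_def
  proof (intro allI impI)
    fix D p assume D: "directed_in (I \<times> P) (sum_le le) D \<and>
      supremum_in (I \<times> P) (sum_le le) D p \<and> sum_le le (i, y) p"
    then obtain k D' where D': "k \<in> I" "directed_in P le D'" "D = Pair k ` D'"
      using directed_in_sumE by metis
    moreover have "D' \<noteq> {}" using D' by (auto simp: directed_in_def)
    ultimately obtain s where "p = (k, s)" "supremum_in P le D' s"
      using D by (auto simp: supremum_in_fibre_iff)
    with D D' wb show "\<exists>z\<in>D. sum_le le (j, x) z"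
      unfolding way_below_def by fastforce
  qed
qed

text \<open>The Scott topology of the sum order is the coproduct of the Scott topologies, because a
  directed set stays in one fibre.\<close>

lemma scott_open_sum_iff:
  "scott_open (I \<times> P) (sum_le le) W \<longleftrightarrow>
     W \<subseteq> I \<times> P \<and> (\<forall>i\<in>I. scott_open P le {x. (i, x) \<in> W})" (is "?L \<longleftrightarrow> ?R")
proof
  assume W: ?L
  show ?R
  proof (intro conjI ballI)
    show "W \<subseteq> I \<times> P" using W by (simp add: scott_open_def)
    fix i assume i: "i \<in> I"
    show "scott_open P le {x. (i, x) \<in> W}"
      unfolding scott_open_def
    proof (intro conjI allI impI)
      show "{x. (i, x) \<in> W} \<subseteq> P" using W by (auto simp: scott_open_def)
      show "\<forall>x\<in>{x. (i, x) \<in> W}. \<forall>y\<in>P. le x y \<longrightarrow> y \<in> {x. (i, x) \<in> W}"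
        using W i unfolding scott_open_def by fastforce
      fix D s assume D: "directed_in P le D \<and> supremum_in P le D s \<and> s \<in> {x. (i, x) \<in> W}"
      then have "D \<noteq> {}" by (auto simp: directed_in_def)
      then have "supremum_in (I \<times> P) (sum_le le) (Pair i ` D) (i, s)"
        using D by (simp add: supremum_in_fibre_iff[OF i])
      then have "Pair i ` D \<inter> W \<noteq> {}"
        using D directed_in_fibre[OF i, of P le D] by (intro scott_open_inaccessible[OF W]) auto
      then show "D \<inter> {x. (i, x) \<in> W} \<noteq> {}" by blast
    qed
  qed
next
  assume W: ?R
  show ?L
    unfolding scott_open_def
  proof (intro conjI allI impI)
    show "W \<subseteq> I \<times> P" using W by blast
    show "\<forall>p\<in>W. \<forall>q\<in>I \<times> P. sum_le le p q \<longrightarrow> q \<in> W"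
      using W unfolding scott_open_def by fastforce
    fix D p assume D: "directed_in (I \<times> P) (sum_le le) D \<and>
      supremum_in (I \<times> P) (sum_le le) D p \<and> p \<in> W"
    then obtain k D' where D': "k \<in> I" "directed_in P le D'" "D = Pair k ` D'"
      using directed_in_sumE by metis
    moreover have "D' \<noteq> {}" using D' by (auto simp: directed_in_def)
    ultimately obtain s where "p = (k, s)" "supremum_in P le D' s"
      using D by (auto simp: supremum_in_fibre_iff)
    then have "D' \<inter> {x. (k, x) \<in> W} \<noteq> {}"
      using W D D' by (intro scott_open_inaccessible[of P le _ D' s]) auto
    then show "D \<inter> W \<noteq> {}" using D' by blast
  qed
qed

lemma continuous_dcpo_sum:
  assumes "continuous_dcpo P le"
  shows "continuous_dcpo (I \<times> P) (sum_le le)"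
proof -
  interpret continuous_dcpo P le by fact
  have ne: "D \<noteq> {}" if "directed_in P le D" for D using that by (simp add: directed_in_def)
  show ?thesis
  proof
    show "continuous_dcpo_on (I \<times> P) (sum_le le)"
      unfolding continuous_dcpo_on_def
    proof (intro conjI ballI)
      show "dcpo_on (I \<times> P) (sum_le le)"
        unfolding dcpo_on_def
      proof (intro allI impI)
        fix D assume "directed_in (I \<times> P) (sum_le le) D"
        then obtain i D' where D': "i \<in> I" "directed_in P le D'" "D = Pair i ` D'"
          by (rule directed_in_sumE)
        then obtain s where "supremum_in P le D' s"
          using continuous unfolding continuous_dcpo_on_def dcpo_on_def by blast
        then show "\<exists>s. supremum_in (I \<times> P) (sum_le le) D s"
          using D' ne by (auto simp: supremum_in_fibre_iff)
      qed
      fix q assume "q \<in> I \<times> P"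
      then obtain i y where q: "q = (i, y)" "i \<in> I" "y \<in> P" by blast
      then have eq: "{p \<in> I \<times> P. way_below (I \<times> P) (sum_le le) p q} = Pair i ` {x \<in> P. wb x y}"
        using way_below_sum_iff[of P le i I y] refl by auto
      show "directed_in (I \<times> P) (sum_le le) {p \<in> I \<times> P. way_below (I \<times> P) (sum_le le) p q}"
        unfolding eq using directed_in_fibre directed_wb q by metis
      show "supremum_in (I \<times> P) (sum_le le) {p \<in> I \<times> P. way_below (I \<times> P) (sum_le le) p q} q"
        unfolding eq using supremum_in_fibre_iff[OF q(2) ne[OF directed_wb[OF q(3)]]] supremum_wb q
        by blast
    qed
  next
    show "sum_le le p p" if "p \<in> I \<times> P" for p
      using that refl by (cases p) simp
    show "sum_le le p r"
      if "p \<in> I \<times> P" "q \<in> I \<times> P" "r \<in> I \<times> P" "sum_le le p q" "sum_le le q r" for p q r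
      using that trans[of "snd p" "snd q" "snd r"] by (cases p, cases q, cases r) simp
  qed
qed

text \<open>This presents a coproduct of copies of a pulled-back space as one pullback from one
  dcpo, the form in which \<open>consonant_G_delta\<close> applies.\<close>

lemma sum_topology_pullback:
  "sum_topology (\<lambda>_. pullback_topology A e (scott_topology P le)) I =
     pullback_topology (I \<times> A) (\<lambda>(i, x). (i, e x)) (scott_topology (I \<times> P) (sum_le le))"
  unfolding topology_eq
proof (intro allI iffI)
  fix U
  assume "openin (sum_topology (\<lambda>_. pullback_topology A e (scott_topology P le)) I) U"
  then have U: "U \<subseteq> I \<times> A" and "\<forall>i\<in>I. \<exists>W. scott_open P le W \<and> {x. (i, x) \<in> U} = e -` W \<inter> A"
    by (auto simp: openin_sum_topology openin_pullback_topology topspace_pullback_topology)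
  then obtain W where W: "\<And>i. i \<in> I \<Longrightarrow> scott_open P le (W i)"
    "\<And>i. i \<in> I \<Longrightarrow> {x. (i, x) \<in> U} = e -` W i \<inter> A"
    by metis
  have "{x. (i, x) \<in> Sigma I W} = W i" if "i \<in> I" for i using that by auto
  moreover have "W i \<subseteq> P" if "i \<in> I" for i using W(1)[OF that] by (simp add: scott_open_def)
  ultimately have "scott_open (I \<times> P) (sum_le le) (Sigma I W)"
    unfolding scott_open_sum_iff using W(1) by auto
  moreover have "(i, x) \<in> U \<longleftrightarrow> e x \<in> W i \<and> x \<in> A" if "i \<in> I" for i x
    using W(2)[OF that] by blast
  then have "U = (\<lambda>(i, x). (i, e x)) -` Sigma I W \<inter> I \<times> A"
    using U by auto
  ultimately show "openin (pullback_topology (I \<times> A) (\<lambda>(i, x). (i, e x))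
      (scott_topology (I \<times> P) (sum_le le))) U"
    unfolding openin_pullback_topology by auto
next
  fix U
  assume "openin (pullback_topology (I \<times> A) (\<lambda>(i, x). (i, e x))
      (scott_topology (I \<times> P) (sum_le le))) U"
  then obtain W where W: "W \<subseteq> I \<times> P" "\<And>i. i \<in> I \<Longrightarrow> scott_open P le {x. (i, x) \<in> W}"
    and U: "U = (\<lambda>(i, x). (i, e x)) -` W \<inter> I \<times> A"
    by (auto simp: openin_pullback_topology scott_open_sum_iff)
  have "{x. (i, x) \<in> U} = e -` {x. (i, x) \<in> W} \<inter> A" if "i \<in> I" for i
    using that U by auto
  then show "openin (sum_topology (\<lambda>_. pullback_topology A e (scott_topology P le)) I) U"
    using U W by (fastforce simp: openin_sum_topology openin_pullback_topology topspace_pullback_topology)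
qed

section \<open>Formal balls\<close>

lemma formal_ball_le_refl:
  assumes "quasi_metric_on M d" "b \<in> formal_balls M"
  shows "formal_ball_le d b b"
proof -
  obtain x r where b: "b = (x, r)" "x \<in> M"
    using assms(2) by (auto simp: formal_balls_def)
  then have "d x x = 0"
    using assms(1) by (simp add: quasi_metric_on_def)
  with b show ?thesis
    by (simp add: formal_ball_le_def zero_ennreal.rep_eq)
qed

lemma formal_ball_le_trans:
  assumes "quasi_metric_on M d" "b \<in> formal_balls M" "b' \<in> formal_balls M" "b'' \<in> formal_balls M"
    and "formal_ball_le d b b'" "formal_ball_le d b' b''"
  shows "formal_ball_le d b b''"
proof -
  obtain x r y s z t where b: "b = (x, r)" "b' = (y, s)" "b'' = (z, t)" by (metis prod.exhaust)
  then have "x \<in> M" "y \<in> M" "z \<in> M" using assms by (auto simp: formal_balls_def)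
  then have "d x z \<le> d x y + d y z" using assms(1) by (auto simp: quasi_metric_on_def)
  then have "enn2ereal (d x z) \<le> enn2ereal (d x y) + enn2ereal (d y z)"
    by (simp add: less_eq_ennreal.rep_eq plus_ennreal.rep_eq)
  also have "\<dots> \<le> ereal (r - s) + ereal (s - t)"
    using assms(5,6) b by (intro add_mono) (auto simp: formal_ball_le_def)
  finally show ?thesis using b by (simp add: formal_ball_le_def)
qed

section \<open>Scott continuity of the radius\<close>

lemma formal_ball_le_radius: "formal_ball_le d (x, r) (y, s) \<Longrightarrow> s \<le> r"
  using order_trans[OF enn2ereal_nonneg] unfolding formal_ball_le_def by fastforce

text \<open>Every upper bound has radius at most the infimum. Conversely, completeness applied to a
  translated family supplies the centre of an upper bound whose radius is exactly the
  infimum.\<close>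

lemma supremum_radius:
  assumes dcpo: "dcpo_on (formal_balls M) (formal_ball_le d)"
    and D: "directed_in (formal_balls M) (formal_ball_le d) D"
    and sup: "supremum_in (formal_balls M) (formal_ball_le d) D (x, r)"
  shows "r = Inf (snd ` D)"
proof (rule antisym)
  define s where "s = Inf (snd ` D)"
  have DB: "D \<subseteq> formal_balls M" and "D \<noteq> {}" using D by (auto simp: directed_in_def)
  have pos: "0 \<le> t" if "t \<in> snd ` D" for t using that DB by (auto simp: formal_balls_def)
  have s_le: "s \<le> t" if "(y, t) \<in> D" for y t
    unfolding s_def using that pos by (intro cInf_lower bdd_belowI[of _ 0]) force+
  have "0 \<le> s" unfolding s_def using \<open>D \<noteq> {}\<close> pos by (intro cInf_greatest) auto
  show "r \<le> Inf (snd ` D)"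
    using \<open>D \<noteq> {}\<close> sup formal_ball_le_radius by (intro cInf_greatest) (fastforce simp: supremum_in_def)+
  \<comment> \<open>Lowering all radii by their infimum \<open>s\<close> yields a directed family whose supremum \<open>(y, r')\<close>
    has radius 0; then \<open>(y, s)\<close> bounds \<open>D\<close>, whence \<open>s \<le> r\<close>.\<close>
  let ?sh = "\<lambda>(y, t). (y, t - s)"
  have "directed_in (formal_balls M) (formal_ball_le d) (?sh ` D)"
    unfolding directed_in_def
  proof (intro conjI ballI)
    show "?sh ` D \<subseteq> formal_balls M" "?sh ` D \<noteq> {}"
      using DB s_le \<open>D \<noteq> {}\<close> by (auto simp: formal_balls_def)
    fix b c assume "b \<in> ?sh ` D" "c \<in> ?sh ` D"
    then obtain y t z u where bc: "(y, t) \<in> D" "b = (y, t - s)" "(z, u) \<in> D" "c = (z, u - s)" by auto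
    then obtain w v where "(w, v) \<in> D" "formal_ball_le d (y, t) (w, v)" "formal_ball_le d (z, u) (w, v)"
      using D unfolding directed_in_def by (metis prod.exhaust)
    with bc show "\<exists>a\<in>?sh ` D. formal_ball_le d b a \<and> formal_ball_le d c a"
      by (intro bexI[of _ "(w, v - s)"]) (auto simp: formal_ball_le_def intro: rev_image_eqI)
  qed
  then obtain y r' where y: "supremum_in (formal_balls M) (formal_ball_le d) (?sh ` D) (y, r')"
    using dcpo unfolding dcpo_on_def by (metis prod.exhaust)
  then have r': "0 \<le> r'" "y \<in> M" by (auto simp: supremum_in_def formal_balls_def)
  have le: "formal_ball_le d (z, t - s) (y, r')" if "(z, t) \<in> D" for z t
    using y that by (force simp: supremum_in_def)
  \<comment> \<open>By \<open>le\<close>, the number \<open>r' + s\<close> is a lower bound of the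
    radii in \<open>D\<close>, hence at most their infimum \<open>s\<close>.\<close>
  have "r' + s \<le> s"
    unfolding s_def[symmetric] using \<open>D \<noteq> {}\<close>
    by (subst (2) s_def) (intro cInf_greatest, auto dest!: le formal_ball_le_radius)
  then have "r' = 0" using r' by simp
  then have "formal_ball_le d (z, t) (y, s)" if "(z, t) \<in> D" for z t
    using le[OF that] by (simp add: formal_ball_le_def)
  moreover have "(y, s) \<in> formal_balls M" using r' \<open>0 \<le> s\<close> by (simp add: formal_balls_def)
  ultimately have "formal_ball_le d (x, r) (y, s)"
    using sup unfolding supremum_in_def by fast
  then show "Inf (snd ` D) \<le> r" using formal_ball_le_radius s_def by metis
qed

lemma scott_open_radius_less:
  assumes "dcpo_on (formal_balls M) (formal_ball_le d)"
  shows "scott_open (formal_balls M) (formal_ball_le d) {b \<in> formal_balls M. snd b < \<epsilon>}"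
  unfolding scott_open_def
proof (intro conjI allI impI)
  show "\<forall>b\<in>{b \<in> formal_balls M. snd b < \<epsilon>}. \<forall>c\<in>formal_balls M. formal_ball_le d b c \<longrightarrow>
      c \<in> {b \<in> formal_balls M. snd b < \<epsilon>}"
    using formal_ball_le_radius by fastforce
  fix D b assume D: "directed_in (formal_balls M) (formal_ball_le d) D \<and>
    supremum_in (formal_balls M) (formal_ball_le d) D b \<and> b \<in> {b \<in> formal_balls M. snd b < \<epsilon>}"
  then have "Inf (snd ` D) < \<epsilon>"
    using supremum_radius[OF assms, of D "fst b" "snd b"] by simp
  moreover have "D \<noteq> {}" "D \<subseteq> formal_balls M" using D by (auto simp: directed_in_def)
  ultimately show "D \<inter> {b \<in> formal_balls M. snd b < \<epsilon>} \<noteq> {}"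
    using cInf_lessD[of "snd ` D" \<epsilon>] by auto
qed auto

text \<open>The points of the space are the balls of radius 0, which the sets \<open>V k\<close> cut
  out in all summands simultaneously; so \<open>consonant_G_delta\<close> is applied directly to the
  coproduct.\<close>

lemma odot_consonant_d_scott:
  assumes qm: "quasi_metric_on M d" and Yon: "continuous_Yoneda_complete M d"
  shows "odot_consonant (d_scott_topology M d)"
  unfolding odot_consonant_def
proof
  fix n :: nat
  let ?B = "formal_balls M" and ?I = "{..<n}"
  have "continuous_dcpo ?B (formal_ball_le d)"
  proof
    show "continuous_dcpo_on ?B (formal_ball_le d)"
      using Yon by (simp add: continuous_Yoneda_complete_def)
  qed (fact formal_ball_le_refl[OF qm] formal_ball_le_trans[OF qm])+
  then interpret continuous_dcpo "?I \<times> ?B" "sum_le (formal_ball_le d)"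
    by (rule continuous_dcpo_sum)
  have dcpo: "dcpo_on ?B (formal_ball_le d)"
    using Yon by (simp add: continuous_Yoneda_complete_def continuous_dcpo_on_def)
  \<comment> \<open>The shift to \<open>Suc k\<close> avoids \<open>inverse 0 = 0\<close>, for which
    the set would be empty.\<close>
  define V where "V k = ?I \<times> {b \<in> ?B. snd b < inverse (real (Suc k))}" for k
  have "{b. (i, b) \<in> V k} = {b \<in> ?B. snd b < inverse (real (Suc k))}" if "i \<in> ?I" for i k
    using that by (auto simp: V_def)
  then have V: "scott_open (?I \<times> ?B) (sum_le (formal_ball_le d)) (V k)" for k
    unfolding scott_open_sum_iff using scott_open_radius_less[OF dcpo]
    by (simp add: V_def Sigma_mono)
  have zero: "r = 0" if r: "0 \<le> r" "\<And>k. r < inverse (real (Suc k))" for r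
  proof (rule ccontr)
    assume "r \<noteq> 0"
    then obtain k where "inverse (real (Suc k)) < r" using reals_Archimedean[of r] r(1) by auto
    then show False using r(2)[of k] by simp
  qed
  have "(\<lambda>(i, x). (i, (x, 0))) ` (?I \<times> M) = (\<Inter>k. V k)"
  proof (intro equalityI subsetI)
    fix p assume p: "p \<in> (\<Inter>k. V k)"
    obtain i x r where ixr: "p = (i, (x, r))" by (metis prod.exhaust)
    have "i \<in> ?I" "x \<in> M" "0 \<le> r" "\<And>k. r < inverse (real (Suc k))"
      using p by (simp_all add: ixr V_def formal_balls_def)
    then show "p \<in> (\<lambda>(i, x). (i, (x, 0))) ` (?I \<times> M)"
      using zero[of r] ixr by (auto intro: rev_image_eqI)
  qed (auto simp: V_def formal_balls_def)
  from consonant_G_delta[OF V this]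
  show "consonant (sum_topology (\<lambda>_. d_scott_topology M d) ?I)"
    by (simp add: d_scott_topology_def sum_topology_pullback)
qed

text \<open>The example is the second conjunct; combined with the first it gives the equality of
  topologies for those spaces.\<close>

theorem proposition7p7:
  shows "(\<forall>X :: 'a topology. odot_consonant X \<longrightarrow>
            compact_open_topology X = lsc_scott_topology X) \<and>
         (\<forall>(M :: 'b set) d. quasi_metric_on M d \<and> continuous_Yoneda_complete M d \<longrightarrow>
            odot_consonant (d_scott_topology M d))"
  using compact_open_eq_lsc_scott odot_consonant_d_scott by blast

end
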